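(* Let $U,V\subset\mathbb{R}^n$ be open and connected, and let $\psi:U\times V\to\mathbb{R}$ be analytic in $U\times V$ (analytic in both arguments). Then $\psi$ has full rank a.e. in $U\times V$ if and only if, for the Taylor functions $c_s$ of $\psi$ about any point $p\in V$ and every $k\in\mathbb{N}$, there is a set of $k$ functions $c_s$ that are locally linear independent in $U$.
   Context: Multi-index notation: for $s=(s_1,\dots,s_n)\in\mathbb{Z}_{\ge0}^n$, $[s]=s_1+\dots+s_n$ and $(y-p)^s=(y_1-p_1)^{s_1}\cdots(y_n-p_n)^{s_n}$. A function $\psi:U\times V\to\mathbb{R}$ is analytic in $V$ if about any $p\in V$ one can write $$\psi(x,y)=\sum_{l=0}^\infty\ \sum_{s:[s]=l}c_s(x)(y-p)^s$$ for some functions $c_s$ on $U$ (depending on $p$), where the series converges to $\psi(x,y)$ for any $(x,y)\in U\times V$. The $c_s$ are called the Taylor functions of $\psi$ about $p$; $c_s(x)=\frac{1}{s!}\frac{\partial^s\psi}{\partial y^s}(x,p)$. It is moreover assumed that for all $x\in U$, $p\in V$ the closed ball centred at $p$ whose radius is the convergence radius of this series encloses $V$. If in addition, for every $p\in V$, all $c_s$ are real analytic in $U$, then $\psi$ is called analytic in $U\times V$ (analytic in both arguments). A collection of functions $f_s:U\to\mathbb{R}$ is locally linear independent in $U$ if for every nonempty open $W\subset U$: $\sum_s\alpha_sf_s(x)=0$ for (Lebesgue) almost every $x\in W$ if and only if $\alpha_s=0$ for all $s$. $\psi$ has full rank almost everywhere (a.e.) in $U\times V$ if for any $k\in\mathbb{N}$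 and any nonempty open sets $U_i\subset U$, $V_j\subset V$, $i,j=1,\dots,k$, there exist $x_i\in U_i$ and $y_j\in V_j$ such that the matrix $\{\psi(x_i,y_j)\}_{i,j=1}^k$ has rank $k$. *)

theory Defs
  imports "HOL-Analysis.Analysis" "Jordan_Normal_Form.DL_Rank"
begin

text \<open>
  Multi-indices are functions \<open>'n \<Rightarrow> nat\<close> on the finite coordinate type \<open>'n\<close>;
  \<open>mdegree s\<close> is the number written [s], and \<open>mpower h s\<close> is the monomial \<open>h\<close> to the \<open>s\<close>.
  Both \<open>Finite_Cartesian_Product\<close> and \<open>Jordan_Normal_Form.Matrix\<close> use the infix dollar sign, so
  components of \<open>real ^ 'n\<close> are written with \<^const>\<open>vec_nth\<close>.
\<close>

definition mdegree :: "('n::finite \<Rightarrow> nat) \<Rightarrow> nat" where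
  "mdegree s = (\<Sum>i\<in>UNIV. s i)"

definition mpower :: "real ^ 'n::finite \<Rightarrow> ('n \<Rightarrow> nat) \<Rightarrow> real" where
  "mpower h s = (\<Prod>i\<in>UNIV. vec_nth h i ^ s i)"

text \<open>
  The part of degree \<open>l\<close> of a power series in several variables; it is a finite sum, as only
  finitely many multi-indices have a given degree. The series in \<open>mconv_radius\<close> and \<open>taylor_functions\<close>
  are summed over \<open>l\<close>, with each homogeneous part being one term.
\<close>

definition homogeneous_part :: "(('n::finite \<Rightarrow> nat) \<Rightarrow> real) \<Rightarrow> real ^ 'n \<Rightarrow> nat \<Rightarrow> real" where
  "homogeneous_part a h l = (\<Sum>s | mdegree s = l. a s * mpower h s)"

definition mconv_radius :: "(('n::finite \<Rightarrow> nat) \<Rightarrow> real) \<Rightarrow> ereal" where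
  "mconv_radius a =
     Sup {ereal r | r. r \<ge> 0 \<and> (\<forall>h. norm h < r \<longrightarrow> summable (homogeneous_part a h))}"

definition taylor_functions ::
  "(real ^ 'n::finite) set \<Rightarrow> (real ^ 'n) set \<Rightarrow> (real ^ 'n \<Rightarrow> real ^ 'n \<Rightarrow> real) \<Rightarrow> real ^ 'n
    \<Rightarrow> (('n \<Rightarrow> nat) \<Rightarrow> real ^ 'n \<Rightarrow> real) \<Rightarrow> bool" where
  "taylor_functions U V \<psi> p c \<longleftrightarrow>
     (\<forall>x\<in>U. \<forall>y\<in>V. homogeneous_part (\<lambda>s. c s x) (y - p) sums \<psi> x y)"

text \<open>
  The last conjunct says that the closed ball about \<open>p\<close> whose radius is the (possibly infinite)
  radius of convergence contains \<open>V\<close>.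
\<close>

definition analytic_in_second ::
  "(real ^ 'n::finite) set \<Rightarrow> (real ^ 'n) set \<Rightarrow> (real ^ 'n \<Rightarrow> real ^ 'n \<Rightarrow> real) \<Rightarrow> bool" where
  "analytic_in_second U V \<psi> \<longleftrightarrow>
     (\<forall>p\<in>V. \<exists>c. taylor_functions U V \<psi> p c \<and>
        (\<forall>x\<in>U. V \<subseteq> {y. ereal (dist p y) \<le> mconv_radius (\<lambda>s. c s x)}))"

text \<open>
  Real analyticity of a function of several variables on an open set. Here the local power
  series converges unconditionally over all multi-indices, which is the case near the centre
  of any convergent power series.
\<close>

definition real_analytic_on :: "(real ^ 'n::finite \<Rightarrow> real) \<Rightarrow> (real ^ 'n) set \<Rightarrow> bool" where
  "real_analytic_on f U \<longleftrightarrow>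
     (\<forall>q\<in>U. \<exists>\<epsilon>>0. \<exists>a. ball q \<epsilon> \<subseteq> U \<and>
        (\<forall>x\<in>ball q \<epsilon>. ((\<lambda>s. a s * mpower (x - q) s) has_sum f x) UNIV))"

definition analytic_in_both ::
  "(real ^ 'n::finite) set \<Rightarrow> (real ^ 'n) set \<Rightarrow> (real ^ 'n \<Rightarrow> real ^ 'n \<Rightarrow> real) \<Rightarrow> bool" where
  "analytic_in_both U V \<psi> \<longleftrightarrow>
     analytic_in_second U V \<psi> \<and>
     (\<forall>p\<in>V. \<forall>c. taylor_functions U V \<psi> p c \<longrightarrow> (\<forall>s. real_analytic_on (c s) U))"

text \<open>Used for finite index sets \<open>S\<close> only.\<close>

definition locally_lin_indep ::
  "'i set \<Rightarrow> ('i \<Rightarrow> real ^ 'n::finite \<Rightarrow> real) \<Rightarrow> (real ^ 'n) set \<Rightarrow> bool" where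
  "locally_lin_indep S f U \<longleftrightarrow>
     (\<forall>W. open W \<and> W \<noteq> {} \<and> W \<subseteq> U \<longrightarrow>
        (\<forall>\<alpha>. (AE x in lebesgue. x \<in> W \<longrightarrow> (\<Sum>s\<in>S. \<alpha> s * f s x) = 0) \<longleftrightarrow> (\<forall>s\<in>S. \<alpha> s = 0)))"

text \<open>
  The \<open>k\<close> points and sets are indexed by \<open>0, \<dots>, k - 1\<close>; \<open>vec_space.rank k\<close> is the rank of
  a matrix with \<open>k\<close> rows.
\<close>

definition full_rank_ae ::
  "(real ^ 'n::finite) set \<Rightarrow> (real ^ 'n) set \<Rightarrow> (real ^ 'n \<Rightarrow> real ^ 'n \<Rightarrow> real) \<Rightarrow> bool" where
  "full_rank_ae U V \<psi> \<longleftrightarrow>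
     (\<forall>k::nat. \<forall>A B.
        (\<forall>i<k. open (A i) \<and> A i \<noteq> {} \<and> A i \<subseteq> U) \<and>
        (\<forall>j<k. open (B j) \<and> B j \<noteq> {} \<and> B j \<subseteq> V) \<longrightarrow>
        (\<exists>x y. (\<forall>i<k. x i \<in> A i) \<and> (\<forall>j<k. y j \<in> B j) \<and>
           vec_space.rank k (Matrix.mat k k (\<lambda>(i, j). \<psi> (x i) (y j))) = k))"

end

theory Submission
  imports Defs "HOL-Complex_Analysis.Conformal_Mappings"
begin

text \<open>
  Fix points \<open>x 0, \<dots>, x (k - 1)\<close> of \<open>U\<close>. The function \<open>\<Sum>i<k. v i * \<psi> (x i) y\<close> of \<open>y\<close> has the
  Taylor coefficients \<open>\<Sum>i<k. v i * c s (x i)\<close> about \<open>p\<close>, and these all vanish as soon as the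
  function vanishes on some nonempty open subset of \<open>V\<close>. So the vectors \<open>(\<psi> (x i) y)\<^sub>i\<close>, with \<open>y\<close>
  running over any such subset, have the same annihilator as the vectors \<open>(c s (x i))\<^sub>i\<close>, with \<open>s\<close>
  running over all multi-indices. Functions that are linearly independent on each of \<open>k\<close> sets have
  a nonsingular evaluation matrix at points chosen from these sets; applied once in the variable
  \<open>x\<close> and once in \<open>y\<close> or \<open>s\<close>, this gives both implications. Local linear independence of the
  \<open>c s\<close> follows from linear independence on \<open>U\<close> by the identity theorem for real analytic functions.
\<close>

section \<open>Series of homogeneous polynomials vanishing on an open set\<close>

text \<open>Convergence at a real point beyond 1 makes the complexified series holomorphic on a disc
  with 1 in its interior. Its zeros accumulate at 1, so it vanishes on the whole disc and all
  coefficients are zero.\<close>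

lemma power_series_zero_near_1:
  fixes b :: "nat \<Rightarrow> real"
  assumes "e > 0" and sums: "\<And>t. \<bar>t - 1\<bar> < e \<Longrightarrow> (\<lambda>l. b l * t ^ l) sums 0"
  shows "b l = 0"
proof -
  define r where "r = 1 + e / 2"
  have r: "r > 1" "\<bar>r - 1\<bar> < e" using assms(1) by (auto simp: r_def)
  define F where "F z = (\<Sum>l. complex_of_real (b l) * z ^ l)" for z
  have sm: "summable (\<lambda>l. complex_of_real (b l) * of_real r ^ l)"
    using sums_summable[OF sums_of_real[OF sums[OF r(2)], where ?'a = complex]] by simp
  have F: "(\<lambda>l. complex_of_real (b l) * (z - 0) ^ l) sums F z" if "z \<in> ball 0 r" for z
    using powser_inside[OF sm, of z] that r(1) by (auto simp: F_def dist_norm summable_sums)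
  have hol: "F holomorphic_on ball 0 r"
    by (rule power_series_holomorphic[where a = "\<lambda>l. complex_of_real (b l)"]) (use F in auto)
  define T where "T = complex_of_real ` {1<..<r}"
  have lim: "1 islimpt T"
    unfolding islimpt_approachable
  proof (intro allI impI)
    fix d :: real assume "d > 0"
    define t where "t = 1 + min (d / 2) (e / 4)"
    have "t \<in> {1<..<r}" "\<bar>t - 1\<bar> < d" "t \<noteq> 1"
      using \<open>d > 0\<close> \<open>e > 0\<close> by (auto simp: t_def r_def min_def)
    moreover have "dist (complex_of_real t) 1 = \<bar>t - 1\<bar>"
      by (metis dist_of_real dist_real_def of_real_1)
    ultimately show "\<exists>z\<in>T. z \<noteq> 1 \<and> dist z 1 < d"
      by (intro bexI[of _ "complex_of_real t"]) (auto simp: T_def)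
  qed
  have FT: "F z = 0" if "z \<in> T" for z
  proof -
    obtain t where t: "z = of_real t" "1 < t" "t < r" using \<open>z \<in> T\<close> by (auto simp: T_def)
    have "(\<lambda>l. b l * t ^ l) sums 0" using t r by (intro sums) auto
    hence "(\<lambda>l. complex_of_real (b l) * z ^ l) sums 0"
      using sums_of_real[where ?'a = complex, of "\<lambda>l. b l * t ^ l" 0] by (simp add: t)
    thus ?thesis by (simp add: F_def sums_iff)
  qed
  have F0: "F z = 0" if "z \<in> ball 0 r" for z
    by (rule analytic_continuation[OF hol, of T 1]) (use lim FT that r in \<open>auto simp: T_def\<close>)
  show ?thesis
  proof (rule ccontr)
    assume nz: "b l \<noteq> 0"
    \<comment> \<open>\<open>powser_0_nonzero\<close> isolates the zero at 0 by means of a nonzero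
      coefficient of positive index, so index 0 is settled first.\<close>
    have "F 0 = complex_of_real (b 0)" by (simp add: F_def)
    hence "b 0 = 0" using F0[of 0] r by auto
    hence "l > 0" using nz by (cases l) auto
    obtain s where s: "s > 0" "\<And>z. z \<in> cball 0 s - {0} \<Longrightarrow> F z \<noteq> 0"
      by (rule powser_0_nonzero[of r 0 "\<lambda>l. complex_of_real (b l)" F l])
        (use F F0 r nz \<open>l > 0\<close> in \<open>auto simp: dist_norm\<close>)
    have "F (of_real (min s 1)) = 0" by (rule F0) (use s(1) r in \<open>auto simp: min_def\<close>)
    moreover have "F (of_real (min s 1)) \<noteq> 0" by (rule s(2)) (use s(1) in \<open>auto simp: min_def\<close>)
    ultimately show False by blast
  qed
qed

text \<open>Induction on the set of variables: with the others fixed, the sum is a polynomial in the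
  new variable with infinitely many roots, so its coefficients vanish, and these are sums of the
  same kind in fewer variables. That \<open>J\<close> separates the members of \<open>T\<close>
  makes distinct terms distinct monomials.\<close>

lemma multivariate_polynomial_zero:
  fixes a :: "('i \<Rightarrow> nat) \<Rightarrow> real"
  assumes "finite J" and "finite T" and "\<And>i. i \<in> J \<Longrightarrow> infinite (I i)"
    and "\<And>s s'. \<lbrakk>s \<in> T; s' \<in> T; \<forall>i\<in>J. s i = s' i\<rbrakk> \<Longrightarrow> s = s'"
    and "\<And>h. \<forall>i\<in>J. h i \<in> I i \<Longrightarrow> (\<Sum>s\<in>T. a s * (\<Prod>i\<in>J. h i ^ s i)) = 0"
  shows "\<forall>s\<in>T. a s = 0"
  using assms
proof (induction J arbitrary: T rule: finite_induct)
  case empty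
  have eq: "(\<Sum>s\<in>T. a s) = 0" using empty.prems(4)[of undefined] by simp
  show ?case
  proof
    fix s assume "s \<in> T"
    hence "T = {s}" using empty.prems(3) by blast
    thus "a s = 0" using eq by simp
  qed
next
  case (insert j J)
  define N where "N = (\<Sum>s\<in>T. s j)"
  have N: "s j \<le> N" if "s \<in> T" for s
    unfolding N_def using that insert.prems(1) by (intro member_le_sum) auto
  have C0: "(\<Sum>s\<in>{s\<in>T. s j = m}. a s * (\<Prod>i\<in>J. h i ^ s i)) = 0"
    if h: "\<forall>i\<in>J. h i \<in> I i" and "m \<le> N" for h m
  proof -
    define C where "C m = (\<Sum>s\<in>{s\<in>T. s j = m}. a s * (\<Prod>i\<in>J. h i ^ s i))" for m
    have "(\<Sum>m\<le>N. C m * x ^ m) = 0" if x: "x \<in> I j" for x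
    proof -
      have "(\<Sum>m\<le>N. C m * x ^ m)
          = (\<Sum>m\<le>N. \<Sum>s\<in>{s\<in>T. s j = m}. a s * (\<Prod>i\<in>insert j J. (h(j := x)) i ^ s i))"
      proof (intro sum.cong refl)
        fix m
        have "(\<Prod>i\<in>J. (h(j := x)) i ^ s i) = (\<Prod>i\<in>J. h i ^ s i)" for s
          using insert.hyps by (intro prod.cong) auto
        thus "C m * x ^ m = (\<Sum>s\<in>{s\<in>T. s j = m}. a s * (\<Prod>i\<in>insert j J. (h(j := x)) i ^ s i))"
          using insert.hyps unfolding C_def sum_distrib_right by (intro sum.cong) auto
      qed
      also have "\<dots> = (\<Sum>s\<in>T. a s * (\<Prod>i\<in>insert j J. (h(j := x)) i ^ s i))"
        using insert.prems(1) N by (intro sum.group) auto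
      also have "\<dots> = 0"
        using h x insert.hyps by (intro insert.prems(4)) auto
      finally show ?thesis .
    qed
    hence "I j \<subseteq> {x. (\<Sum>m\<le>N. C m * x ^ m) = 0}" by blast
    hence "infinite {x. (\<Sum>m\<le>N. C m * x ^ m) = 0}"
      using insert.prems(2)[of j] finite_subset by blast
    thus ?thesis using \<open>m \<le> N\<close> by (auto simp: polyfun_finite_roots C_def)
  qed
  show ?case
  proof
    fix s assume s: "s \<in> T"
    \<comment> \<open>On this fibre the exponent of \<open>j\<close> is constant, so its members are
      already separated by \<open>J\<close>.\<close>
    have "\<forall>s'\<in>{s'\<in>T. s' j = s j}. a s' = 0"
    proof (rule insert.IH)
      show "finite {s'\<in>T. s' j = s j}" using insert.prems(1) by simp
      show "infinite (I i)" if "i \<in> J" for i using that insert.prems(2) by blast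
      show "s1 = s2" if "s1 \<in> {s'\<in>T. s' j = s j}" "s2 \<in> {s'\<in>T. s' j = s j}"
          "\<forall>i\<in>J. s1 i = s2 i" for s1 s2
        using that by (intro insert.prems(3)) auto
    qed (use C0 N s in auto)
    thus "a s = 0" using s by blast
  qed
qed

lemma finite_mdegree: "finite {s :: 'n::finite \<Rightarrow> nat. mdegree s = l}"
proof (rule finite_subset)
  show "{s :: 'n \<Rightarrow> nat. mdegree s = l} \<subseteq> PiE UNIV (\<lambda>_. {..l})"
    by (auto simp: mdegree_def intro: member_le_sum)
  show "finite (PiE (UNIV :: 'n set) (\<lambda>_. {..l}))" by (intro finite_PiE) auto
qed

lemma homogeneous_part_scaleR:
  "homogeneous_part a (t *\<^sub>R h) l = t ^ l * homogeneous_part a h l"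
proof -
  have "mpower (t *\<^sub>R h) s = t ^ mdegree s * mpower h s" for s
    by (simp add: mpower_def mdegree_def power_mult_distrib prod.distrib power_sum)
  thus ?thesis by (auto simp: homogeneous_part_def sum_distrib_left mult_ac intro!: sum.cong)
qed

text \<open>An open set contains a box, that is, a product of infinite sets, to which
  \<open>multivariate_polynomial_zero\<close> applies.\<close>

lemma homogeneous_part_zero_on_open:
  fixes a :: "('n::finite \<Rightarrow> nat) \<Rightarrow> real"
  assumes "open O'" "O' \<noteq> {}" and zero: "\<And>h. h \<in> O' \<Longrightarrow> homogeneous_part a h (mdegree s) = 0"
  shows "a s = 0"
proof -
  obtain h0 where "h0 \<in> O'" using assms(2) by blast
  then obtain e where e: "e > 0" "ball h0 e \<subseteq> O'" using assms(1) openE by blast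
  \<comment> \<open>A box of this half-width lies in the ball, as the norm is at most the sum of the
    absolute values of the coordinates.\<close>
  define d where "d = e / real CARD('n)"
  have d: "d > 0" using e by (simp add: d_def)
  define I where "I i = {vec_nth h0 i - d<..<vec_nth h0 i + d}" for i
  have "\<forall>s'\<in>{s'. mdegree s' = mdegree s}. a s' = 0"
  proof (rule multivariate_polynomial_zero[of UNIV _ I])
    show "infinite (I i)" for i using d by (simp add: I_def infinite_Ioo)
    fix h assume h: "\<forall>i\<in>UNIV. h i \<in> I i"
    have "norm ((\<chi> i. h i) - h0) \<le> (\<Sum>i\<in>UNIV. \<bar>vec_nth ((\<chi> i. h i) - h0) i\<bar>)"
      by (rule norm_le_l1_cart)
    also have "\<dots> < (\<Sum>i\<in>(UNIV :: 'n set). d)"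
      using h by (intro sum_strict_mono) (auto simp: I_def abs_less_iff algebra_simps)
    also have "\<dots> = e" by (simp add: d_def)
    finally have "(\<chi> i. h i) \<in> O'"
      using e by (auto simp: dist_norm norm_minus_commute)
    from zero[OF this]
    show "(\<Sum>s'\<in>{s'. mdegree s' = mdegree s}. a s' * (\<Prod>i\<in>UNIV. h i ^ s' i)) = 0"
      by (simp add: homogeneous_part_def mpower_def)
  qed (auto simp: finite_mdegree)
  thus ?thesis by blast
qed

text \<open>
  The open set need not contain the centre: along the ray through one of its points \<open>h\<close>, the
  series is a power series in \<open>t\<close> that vanishes for \<open>t\<close> near \<open>1\<close>.
\<close>

lemma homogeneous_series_zero_on_open:
  fixes a :: "('n::finite \<Rightarrow> nat) \<Rightarrow> real"
  assumes "open O'" "O' \<noteq> {}" and zero: "\<And>h. h \<in> O' \<Longrightarrow> homogeneous_part a h sums 0"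
  shows "a s = 0"
proof (rule homogeneous_part_zero_on_open[OF assms(1,2)])
  fix h assume h: "h \<in> O'"
  have "open ((\<lambda>t. t *\<^sub>R h) -` O')"
    using assms(1) by (intro open_vimage continuous_intros)
  then obtain e where e: "e > 0" "ball 1 e \<subseteq> (\<lambda>t. t *\<^sub>R h) -` O'"
    using h by (elim openE[of _ 1]) auto
  show "homogeneous_part a h (mdegree s) = 0"
  proof (rule power_series_zero_near_1[OF e(1)])
    fix t :: real assume "\<bar>t - 1\<bar> < e"
    hence "t *\<^sub>R h \<in> O'" using e(2) by (auto simp: dist_real_def abs_minus_commute)
    from zero[OF this] show "(\<lambda>l. homogeneous_part a h l * t ^ l) sums 0"
      unfolding homogeneous_part_scaleR[abs_def] by (simp add: mult.commute)
  qed
qed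

section \<open>Real analytic functions\<close>

text \<open>Unconditional convergence permits summation degree by degree; this links the series in
  \<open>real_analytic_on\<close> to the homogeneous series treated above.\<close>

lemma has_sum_imp_homogeneous_part_sums:
  assumes "((\<lambda>s. a s * mpower h s) has_sum f) UNIV"
  shows "homogeneous_part a h sums f"
proof -
  have bij: "bij_betw snd (SIGMA l:UNIV. {s. mdegree s = l}) UNIV"
    by (rule bij_betwI[where g = "\<lambda>s. (mdegree s, s)"]) auto
  have "((\<lambda>z. a (snd z) * mpower h (snd z)) has_sum f) (SIGMA l:UNIV. {s. mdegree s = l})"
    using assms has_sum_reindex_bij_betw[OF bij, of "\<lambda>s. a s * mpower h s" f] by simp
  hence "(homogeneous_part a h has_sum f) UNIV"
    by (rule has_sum_SigmaD) (auto simp: homogeneous_part_def finite_mdegree)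
  thus ?thesis by (rule has_sum_imp_sums)
qed

text \<open>Weierstrass M-test near the centre: convergence at the corner \<open>q + w\<close> of a
  cube is absolute and dominates all terms within the cube, so the series is a uniform limit of
  polynomials there.\<close>

lemma real_analytic_on_imp_continuous_on:
  fixes f :: "real ^ 'n::finite \<Rightarrow> real"
  assumes "real_analytic_on f U"
  shows "continuous_on U f"
proof (rule continuous_at_imp_continuous_on, rule ballI)
  fix q assume "q \<in> U"
  then obtain e a where e: "e > 0"
    and sum: "\<And>x. x \<in> ball q e \<Longrightarrow> ((\<lambda>s. a s * mpower (x - q) s) has_sum f x) UNIV"
    using assms unfolding real_analytic_on_def by blast
  define r where "r = e / (2 * real CARD('n))"
  have r: "r > 0" using e by (simp add: r_def)
  define w :: "real ^ 'n" where "w = (\<chi> i. r)"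
  have "norm w \<le> (\<Sum>i\<in>UNIV. \<bar>vec_nth w i\<bar>)" by (rule norm_le_l1_cart)
  also have "\<dots> = e / 2" using r by (simp add: w_def) (simp add: r_def)
  finally have "q + w \<in> ball q e" using e by (simp add: dist_norm)
  from sum[OF this] have "(\<lambda>s. a s * mpower w s) summable_on UNIV"
    by (auto simp: summable_on_def)
  hence abs: "(\<lambda>s. norm (a s * mpower w s)) summable_on UNIV"
    by (rule iffD1[OF summable_on_iff_abs_summable_on_real])
  define D where "D = ball q (min r e)"
  have "uniform_limit D (\<lambda>S x. \<Sum>s\<in>S. a s * mpower (x - q) s)
          (\<lambda>x. \<Sum>\<^sub>\<infinity>s\<in>UNIV. a s * mpower (x - q) s) (finite_subsets_at_top UNIV)"
  proof (rule Weierstrass_m_test_general[OF _ abs])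
    fix s x assume x: "x \<in> D"
    have "\<bar>vec_nth (x - q) i\<bar> \<le> r" for i
      using component_le_norm_cart[of "x - q" i] x
      by (simp add: D_def dist_norm norm_minus_commute)
    hence "\<bar>mpower (x - q) s\<bar> \<le> mpower w s"
      unfolding mpower_def abs_prod power_abs w_def
      by (intro prod_mono) (auto intro: power_mono)
    thus "norm (a s * mpower (x - q) s) \<le> norm (a s * mpower w s)"
      by (auto simp: abs_mult intro: mult_left_mono)
  qed
  hence "continuous_on D (\<lambda>x. \<Sum>\<^sub>\<infinity>s\<in>UNIV. a s * mpower (x - q) s)"
    by (rule uniform_limit_theorem[rotated])
      (auto simp: mpower_def intro!: always_eventually continuous_intros)
  moreover have "(\<Sum>\<^sub>\<infinity>s\<in>UNIV. a s * mpower (x - q) s) = f x" if "x \<in> D" for x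
    using that sum by (intro infsumI) (auto simp: D_def)
  ultimately have "continuous_on D f" by simp
  thus "isCont f q"
    using r e by (auto simp: D_def continuous_on_eq_continuous_at)
qed

lemma real_analytic_on_linear_combination:
  fixes f :: "'i \<Rightarrow> real ^ 'n::finite \<Rightarrow> real"
  assumes "open U" "finite S" "\<And>s. s \<in> S \<Longrightarrow> real_analytic_on (f s) U"
  shows "real_analytic_on (\<lambda>x. \<Sum>s\<in>S. \<alpha> s * f s x) U"
  using assms(2,3)
proof (induction S rule: finite_induct)
  case empty
  show ?case
    unfolding real_analytic_on_def
  proof
    fix q assume "q \<in> U"
    then obtain e where e: "e > 0" "ball q e \<subseteq> U" using \<open>open U\<close> openE by blast
    thus "\<exists>e>0. \<exists>a. ball q e \<subseteq> U \<and>
        (\<forall>x\<in>ball q e. ((\<lambda>s. a s * mpower (x - q) s) has_sum (\<Sum>s\<in>{}. \<alpha> s * f s x)) UNIV)"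
      by (intro exI[of _ e] conjI exI[of _ "\<lambda>_. 0"]) auto
  qed
next
  case (insert t S)
  have IH: "real_analytic_on (\<lambda>x. \<Sum>s\<in>S. \<alpha> s * f s x) U"
    by (rule insert.IH) (use insert.prems in auto)
  show ?case
    unfolding real_analytic_on_def
  proof
    fix q assume q: "q \<in> U"
    obtain e1 a1 where 1: "e1 > 0" "ball q e1 \<subseteq> U"
      "\<And>x. x \<in> ball q e1 \<Longrightarrow> ((\<lambda>s. a1 s * mpower (x - q) s) has_sum f t x) UNIV"
      using insert.prems[of t] q unfolding real_analytic_on_def by blast
    obtain e2 a2 where 2: "e2 > 0"
      "\<And>x. x \<in> ball q e2 \<Longrightarrow>
        ((\<lambda>s. a2 s * mpower (x - q) s) has_sum (\<Sum>s\<in>S. \<alpha> s * f s x)) UNIV"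
      using IH q unfolding real_analytic_on_def by blast
    have "((\<lambda>s. (\<alpha> t * a1 s + a2 s) * mpower (x - q) s)
        has_sum (\<Sum>s\<in>insert t S. \<alpha> s * f s x)) UNIV" if "x \<in> ball q (min e1 e2)" for x
      using has_sum_add[OF has_sum_cmult_right[OF 1(3), of x "\<alpha> t"] 2(2)[of x]] that insert.hyps
      by (simp add: algebra_simps)
    thus "\<exists>e>0. \<exists>a. ball q e \<subseteq> U \<and>
        (\<forall>x\<in>ball q e. ((\<lambda>s. a s * mpower (x - q) s)
          has_sum (\<Sum>s\<in>insert t S. \<alpha> s * f s x)) UNIV)"
      using 1(1,2) 2(1)
      by (intro exI[of _ "min e1 e2"] conjI exI[of _ "\<lambda>s. \<alpha> t * a1 s + a2 s"]) auto
  qed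
qed

text \<open>The interior \<open>Z\<close> of the zero set is also relatively closed in
  \<open>U\<close>: if the ball of a local expansion meets \<open>Z\<close>, the expansion vanishes
  on an open set, so its coefficients are zero and the ball lies in \<open>Z\<close>. Connectedness
  then gives the claim.\<close>

lemma real_analytic_on_identity:
  fixes f :: "real ^ 'n::finite \<Rightarrow> real"
  assumes f: "real_analytic_on f U" and "connected U"
    and W: "open W" "W \<noteq> {}" "W \<subseteq> U" "\<And>x. x \<in> W \<Longrightarrow> f x = 0"
    and "x \<in> U"
  shows "f x = 0"
proof -
  define Z where "Z = interior {x\<in>U. f x = 0}"
  have key: "\<exists>e>0. ball q e \<subseteq> U \<and> (ball q e \<inter> Z \<noteq> {} \<longrightarrow> ball q e \<subseteq> Z)" if "q \<in> U" for q
  proof -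
    obtain e a where e: "e > 0" "ball q e \<subseteq> U"
      "\<And>x. x \<in> ball q e \<Longrightarrow> ((\<lambda>s. a s * mpower (x - q) s) has_sum f x) UNIV"
      using f \<open>q \<in> U\<close> unfolding real_analytic_on_def by blast
    have sums: "homogeneous_part a (x - q) sums f x" if "x \<in> ball q e" for x
      by (rule has_sum_imp_homogeneous_part_sums[OF e(3)[OF that]])
    have "ball q e \<subseteq> Z" if "ball q e \<inter> Z \<noteq> {}"
    proof -
      have a: "a s = 0" for s
      proof (rule homogeneous_series_zero_on_open)
        \<comment> \<open>This translate of the overlap need not contain 0, the centre of the
          expansion.\<close>
        show "open ((+) (- q) ` (ball q e \<inter> Z))" by (intro open_translation) (auto simp: Z_def)
        show "(+) (- q) ` (ball q e \<inter> Z) \<noteq> {}" using that by simp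
        fix h assume "h \<in> (+) (- q) ` (ball q e \<inter> Z)"
        then obtain x where x: "x \<in> ball q e" "x \<in> Z" "h = x - q" by auto
        have "f x = 0" using x(2) interior_subset unfolding Z_def by blast
        thus "homogeneous_part a h sums 0" using sums[OF x(1)] x(3) by simp
      qed
      have "f x = 0" if "x \<in> ball q e" for x
        using sums[OF that] by (simp add: homogeneous_part_def[abs_def] a sums_iff)
      thus ?thesis unfolding Z_def using e(2) by (intro interior_maximal) auto
    qed
    thus ?thesis using e(1,2) by blast
  qed
  have "open (U - Z)"
    unfolding open_contains_ball
  proof
    fix q assume q: "q \<in> U - Z"
    then obtain e where e: "e > 0" "ball q e \<subseteq> U" "ball q e \<inter> Z \<noteq> {} \<longrightarrow> ball q e \<subseteq> Z"
      using key by blast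
    hence "ball q e \<inter> Z = {}" using q centre_in_ball[of q e] by blast
    thus "\<exists>e>0. ball q e \<subseteq> U - Z" using e by blast
  qed
  hence "Z \<inter> U = {} \<or> (U - Z) \<inter> U = {}"
    by (intro connectedD[OF \<open>connected U\<close>]) (auto simp: Z_def)
  moreover have "W \<subseteq> Z" unfolding Z_def using W by (intro interior_maximal) auto
  ultimately have "x \<in> Z" using W \<open>x \<in> U\<close> by blast
  thus ?thesis using interior_subset unfolding Z_def by blast
qed

text \<open>The points of \<open>W\<close> where \<open>f\<close> is nonzero form an open null set,
  and a nonempty open set is never null.\<close>

lemma AE_zero_imp_zero_on_open:
  fixes f :: "real ^ 'n::finite \<Rightarrow> real"
  assumes "open W" "continuous_on W f" "AE x in lebesgue. x \<in> W \<longrightarrow> f x = 0" "x \<in> W"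
  shows "f x = 0"
proof (rule ccontr)
  assume "f x \<noteq> 0"
  have "open {x\<in>W. f x \<in> - {0}}"
    using continuous_open_preimage[OF assms(2,1), of "- {0}"]
    by (simp add: vimage_def Int_def open_Compl)
  moreover have "AE y\<in>{x\<in>W. f x \<in> - {0}} in lebesgue. y \<in> {}"
    using assms(3) by eventually_elim auto
  ultimately have "x \<in> {}"
    by (rule mem_closed_if_AE_lebesgue_open[OF _ closed_empty])
      (use \<open>f x \<noteq> 0\<close> assms(4) in auto)
  thus False by simp
qed

section \<open>Nonsingular evaluation matrices\<close>

lemma det_nonzero_imp_right_kernel_trivial:
  fixes f :: "nat \<times> nat \<Rightarrow> 'a::field"
  assumes "Determinant.det (Matrix.mat k k f) \<noteq> 0"
    and "\<And>i. i < k \<Longrightarrow> (\<Sum>j<k. f (i, j) * v j) = 0" and "j < k"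
  shows "v j = 0"
proof -
  have "Matrix.mat k k f *\<^sub>v Matrix.vec k v = 0\<^sub>v k"
    using assms(2) by (intro eq_vecI) (auto simp: scalar_prod_def atLeast0LessThan)
  hence "Matrix.vec k v = 0\<^sub>v k"
    using assms(1) det_0_iff_vec_prod_zero[of "Matrix.mat k k f" k] mat_carrier vec_carrier by blast
  thus ?thesis using \<open>j < k\<close> by (metis index_vec index_zero_vec(1))
qed

lemma det_nonzero_imp_left_kernel_trivial:
  fixes f :: "nat \<times> nat \<Rightarrow> 'a::field"
  assumes "Determinant.det (Matrix.mat k k f) \<noteq> 0"
    and "\<And>j. j < k \<Longrightarrow> (\<Sum>i<k. v i * f (i, j)) = 0" and "i < k"
  shows "v i = 0"
proof (rule det_nonzero_imp_right_kernel_trivial[where f = "\<lambda>(i, j). f (j, i)"])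
  have "Matrix.mat k k (\<lambda>(i, j). f (j, i)) = transpose_mat (Matrix.mat k k f)"
    by (intro eq_matI) auto
  thus "Determinant.det (Matrix.mat k k (\<lambda>(i, j). f (j, i))) \<noteq> 0"
    using assms(1) by (simp add: det_transpose[of _ k])
qed (use assms in \<open>auto simp: mult.commute\<close>)

text \<open>
  Border a nonsingular matrix by one row and one column. As a function of the last evaluation point,
  the determinant of the bordered matrix is a linear combination of the \<open>g i\<close> in which the
  coefficient of \<open>g k\<close> is the old determinant.
\<close>

lemma exists_nonsingular_evaluation:
  fixes g :: "nat \<Rightarrow> 'b \<Rightarrow> 'a::field"
  assumes "\<And>j v i. \<lbrakk>j < k; \<forall>y\<in>B j. (\<Sum>i<k. v i * g i y) = 0; i < k\<rbrakk> \<Longrightarrow> v i = 0"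
  shows "\<exists>y. (\<forall>j<k. y j \<in> B j) \<and>
    Determinant.det (Matrix.mat k k (\<lambda>(i, j). g i (y j))) \<noteq> 0"
  using assms
proof (induction k)
  case 0
  show ?case by simp
next
  case (Suc k)
  have "\<exists>y. (\<forall>j<k. y j \<in> B j) \<and>
    Determinant.det (Matrix.mat k k (\<lambda>(i, j). g i (y j))) \<noteq> 0"
  proof (rule Suc.IH)
    fix j i and v :: "nat \<Rightarrow> 'a"
    assume *: "j < k" "\<forall>y\<in>B j. (\<Sum>i<k. v i * g i y) = 0" "i < k"
    \<comment> \<open>Padding with a zero turns a relation among the first \<open>k\<close>
      functions into one among \<open>Suc k\<close>, to which the hypothesis applies.\<close>
    have "(v(k := 0)) i = 0"
      by (rule Suc.prems[of j]) (use * in auto)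
    thus "v i = 0" using *(3) by simp
  qed
  then obtain y where y: "\<And>j. j < k \<Longrightarrow> y j \<in> B j"
    "Determinant.det (Matrix.mat k k (\<lambda>(i, j). g i (y j))) \<noteq> 0" by blast
  define M where "M z = Matrix.mat (Suc k) (Suc k) (\<lambda>(i, j). g i ((y(k := z)) j))" for z
  \<comment> \<open>Cofactors along the last column do not involve that column, so any value may
    stand for the last point.\<close>
  define C where "C i = cofactor (M undefined) i k" for i
  have cof: "cofactor (M z) i k = C i" if "i < Suc k" for i z
  proof -
    have "mat_delete (M z) i k = mat_delete (M undefined) i k"
      by (intro eq_matI) (use that in \<open>auto simp: mat_delete_def M_def\<close>)
    thus ?thesis by (simp add: C_def cofactor_def)
  qed
  have det: "Determinant.det (M z) = (\<Sum>i<Suc k. C i * g i z)" for z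
  proof -
    have "Determinant.det (M z) = (\<Sum>i<Suc k. M z $$ (i, k) * cofactor (M z) i k)"
      by (rule laplace_expansion_column) (auto simp: M_def)
    also have "\<dots> = (\<Sum>i<Suc k. C i * g i z)"
      by (intro sum.cong refl, subst cof) (auto simp: M_def)
    finally show ?thesis .
  qed
  have "mat_delete (M undefined) k k = Matrix.mat k k (\<lambda>(i, j). g i (y j))"
    by (intro eq_matI) (auto simp: mat_delete_def M_def)
  hence "C k \<noteq> 0" using y(2) by (simp add: C_def cofactor_def)
  hence "\<not> (\<forall>z\<in>B k. (\<Sum>i<Suc k. C i * g i z) = 0)" using Suc.prems[of k C k] by blast
  then obtain z where z: "z \<in> B k" "Determinant.det (M z) \<noteq> 0" by (auto simp: det)
  show ?case
    by (rule exI[of _ "y(k := z)"]) (use y(1) z in \<open>auto simp: M_def less_Suc_eq\<close>)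
qed

lemma full_rank_ae_iff_det:
  "full_rank_ae U V \<psi> \<longleftrightarrow>
    (\<forall>k A B. (\<forall>i<k. open (A i) \<and> A i \<noteq> {} \<and> A i \<subseteq> U) \<longrightarrow>
       (\<forall>j<k. open (B j) \<and> B j \<noteq> {} \<and> B j \<subseteq> V) \<longrightarrow>
       (\<exists>x y. (\<forall>i<k. x i \<in> A i) \<and> (\<forall>j<k. y j \<in> B j) \<and>
          Determinant.det (Matrix.mat k k (\<lambda>(i, j). \<psi> (x i) (y j))) \<noteq> 0))"
  unfolding full_rank_ae_def
  by (simp only: vec_space.det_rank_iff[OF mat_carrier, symmetric] imp_conjL)

section \<open>Taylor functions\<close>

lemma taylor_functions_linear_combination:
  assumes "taylor_functions U V \<psi> p c" "\<And>i. i < k \<Longrightarrow> x i \<in> U" "y \<in> V"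
  shows "homogeneous_part (\<lambda>s. \<Sum>i<k. v i * c s (x i)) (y - p) sums (\<Sum>i<k. v i * \<psi> (x i) y)"
proof -
  have "homogeneous_part (\<lambda>s. \<Sum>i<k. v i * c s (x i)) h
      = (\<lambda>l. \<Sum>i<k. v i * homogeneous_part (\<lambda>s. c s (x i)) h l)" for h
    unfolding homogeneous_part_def sum_distrib_left sum_distrib_right
    by (subst sum.swap) (simp add: mult_ac)
  moreover have "(\<lambda>l. \<Sum>i<k. v i * homogeneous_part (\<lambda>s. c s (x i)) (y - p) l)
      sums (\<Sum>i<k. v i * \<psi> (x i) y)"
    using assms unfolding taylor_functions_def by (intro sums_sum sums_mult) auto
  ultimately show ?thesis by simp
qed

text \<open>The expansion about \<open>p\<close> vanishes on the translate of \<open>B\<close> by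
  \<open>- p\<close>, an open set that may lie away from 0, so each of its coefficients is
  zero.\<close>

lemma taylor_functions_annihilator:
  assumes c: "taylor_functions U V \<psi> p c" "\<And>i. i < k \<Longrightarrow> x i \<in> U"
    and B: "open B" "B \<noteq> {}" "B \<subseteq> V" "\<And>y. y \<in> B \<Longrightarrow> (\<Sum>i<k. v i * \<psi> (x i) y) = 0"
  shows "(\<Sum>i<k. v i * c s (x i)) = 0"
proof (rule homogeneous_series_zero_on_open[where a = "\<lambda>s. \<Sum>i<k. v i * c s (x i)"])
  show "open ((+) (- p) ` B)" using B(1) by (rule open_translation)
  show "(+) (- p) ` B \<noteq> {}" using B(2) by simp
  fix h assume "h \<in> (+) (- p) ` B"
  then obtain y where y: "y \<in> B" "h = y - p" by auto
  thus "homogeneous_part (\<lambda>s. \<Sum>i<k. v i * c s (x i)) h sums 0"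
    using taylor_functions_linear_combination[of U V \<psi> p c k x y v] c B(3,4) by auto
qed

section \<open>Full rank and local linear independence of the Taylor functions\<close>

lemma infinite_multi_indices: "infinite (UNIV :: ('n::finite \<Rightarrow> nat) set)"
  by (simp add: finite_UNIV_fun)

text \<open>Independence of the \<open>c s\<close> on each \<open>A i\<close> yields the points
  \<open>x i\<close>. By \<open>taylor_functions_annihilator\<close> the functions
  \<open>\<psi> (x i)\<close> are then independent on each \<open>B j\<close>, which yields the
  points \<open>y j\<close>. The centre \<open>p\<close> may vary with \<open>k\<close>.\<close>

lemma locally_lin_indep_imp_full_rank_ae:
  fixes U V :: "(real ^ 'n::finite) set"
  assumes "\<And>k. \<exists>p\<in>V. \<exists>c S. taylor_functions U V \<psi> p c \<and>
    finite S \<and> card S = k \<and> locally_lin_indep S c U"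
  shows "full_rank_ae U V \<psi>"
  unfolding full_rank_ae_iff_det
proof (intro allI impI)
  fix k :: nat and A B :: "nat \<Rightarrow> (real ^ 'n) set"
  assume A: "\<forall>i<k. open (A i) \<and> A i \<noteq> {} \<and> A i \<subseteq> U"
    and B: "\<forall>j<k. open (B j) \<and> B j \<noteq> {} \<and> B j \<subseteq> V"
  obtain p c S where c: "taylor_functions U V \<psi> p c"
    and S: "finite S" "card S = k" "locally_lin_indep S c U"
    using assms[of k] by blast
  obtain s where s: "bij_betw s {..<k} S"
    using ex_bij_betw_nat_finite[OF S(1)] S(2) by (auto simp: atLeast0LessThan)
  \<comment> \<open>Rows belong to the functions and columns to the points, so a relation between
    the points is a right kernel vector.\<close>
  have "\<exists>x. (\<forall>i<k. x i \<in> A i) \<and>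
    Determinant.det (Matrix.mat k k (\<lambda>(j, i). c (s j) (x i))) \<noteq> 0"
  proof (rule exists_nonsingular_evaluation)
    fix i j and v :: "nat \<Rightarrow> real"
    assume i: "i < k" and v: "\<forall>x\<in>A i. (\<Sum>j<k. v j * c (s j) x) = 0" and j: "j < k"
    \<comment> \<open>The coefficients \<open>v\<close>, numbered by position, are transported to
      the multi-indices in \<open>S\<close>.\<close>
    define \<alpha> where "\<alpha> = v \<circ> the_inv_into {..<k} s"
    have \<alpha>: "\<alpha> (s j) = v j" if "j < k" for j
      using s that by (simp add: \<alpha>_def bij_betw_def the_inv_into_f_f)
    have "(\<Sum>t\<in>S. \<alpha> t * c t x) = (\<Sum>j<k. v j * c (s j) x)" for x
      using sum.reindex_bij_betw[OF s, of "\<lambda>t. \<alpha> t * c t x"] by (simp add: \<alpha>)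
    hence "AE x in lebesgue. x \<in> A i \<longrightarrow> (\<Sum>t\<in>S. \<alpha> t * c t x) = 0"
      using v by (intro AE_I2) auto
    hence "\<forall>t\<in>S. \<alpha> t = 0"
      using S(3)[unfolded locally_lin_indep_def, rule_format, of "A i" \<alpha>] A i by simp
    thus "v j = 0" using \<alpha>[OF j] s j by (auto simp: bij_betw_def)
  qed
  then obtain x where x: "\<And>i. i < k \<Longrightarrow> x i \<in> A i"
    and det: "Determinant.det (Matrix.mat k k (\<lambda>(j, i). c (s j) (x i))) \<noteq> 0" by blast
  have xU: "\<And>i. i < k \<Longrightarrow> x i \<in> U" using x A by blast
  have "\<exists>y. (\<forall>j<k. y j \<in> B j) \<and>
    Determinant.det (Matrix.mat k k (\<lambda>(i, j). \<psi> (x i) (y j))) \<noteq> 0"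
  proof (rule exists_nonsingular_evaluation)
    fix j i and v :: "nat \<Rightarrow> real"
    assume j: "j < k" and v: "\<forall>y\<in>B j. (\<Sum>i<k. v i * \<psi> (x i) y) = 0" and i: "i < k"
    have zero: "(\<Sum>i<k. v i * c t (x i)) = 0" for t
      by (rule taylor_functions_annihilator[OF c xU, where B = "B j"]) (use B j v in auto)
    show "v i = 0"
      by (rule det_nonzero_imp_right_kernel_trivial[OF det _ i, where v = v])
        (use zero in \<open>simp add: mult.commute\<close>)
  qed
  thus "\<exists>x y. (\<forall>i<k. x i \<in> A i) \<and> (\<forall>j<k. y j \<in> B j) \<and>
      Determinant.det (Matrix.mat k k (\<lambda>(i, j). \<psi> (x i) (y j))) \<noteq> 0"
    using x by blast
qed

text \<open>A relation satisfied by \<open>c s (x i)\<close> for every \<open>s\<close> passes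
  through the Taylor series to the rows of a nonsingular matrix of values of \<open>\<psi>\<close>,
  so it is trivial. Hence \<open>k\<close> multi-indices have a nonsingular evaluation matrix at the
  \<open>x i\<close>, and their Taylor functions are independent on \<open>U\<close>.\<close>

lemma full_rank_ae_imp_locally_lin_indep:
  fixes U V :: "(real ^ 'n::finite) set"
  assumes "open U" "connected U" "open V" "V \<noteq> {}"
    and rank: "full_rank_ae U V \<psi>"
    and c: "taylor_functions U V \<psi> p c" and analytic: "\<And>s. real_analytic_on (c s) U"
  shows "\<exists>S. finite S \<and> card S = k \<and> locally_lin_indep S c U"
proof (cases "U = {}")
  case True
  \<comment> \<open>No nonempty \<open>W\<close> fits into the empty set, so any \<open>k\<close>
    multi-indices serve.\<close>
  obtain S :: "('n \<Rightarrow> nat) set" where "finite S" "card S = k"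
    using infinite_arbitrarily_large[OF infinite_multi_indices] by blast
  thus ?thesis using True unfolding locally_lin_indep_def by blast
next
  case False
  have "\<exists>x y. (\<forall>i<k. x i \<in> U) \<and> (\<forall>j<k. y j \<in> V) \<and>
      Determinant.det (Matrix.mat k k (\<lambda>(i, j). \<psi> (x i) (y j))) \<noteq> 0"
    using rank[unfolded full_rank_ae_iff_det, rule_format, of k "\<lambda>_. U" "\<lambda>_. V"] assms False
    by simp
  then obtain x y where x: "\<And>i. i < k \<Longrightarrow> x i \<in> U" and y: "\<And>j. j < k \<Longrightarrow> y j \<in> V"
    and det: "Determinant.det (Matrix.mat k k (\<lambda>(i, j). \<psi> (x i) (y j))) \<noteq> 0" by blast
  have "\<exists>s. (\<forall>j<k. s j \<in> UNIV) \<and>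
    Determinant.det (Matrix.mat k k (\<lambda>(i, j). c (s j) (x i))) \<noteq> 0"
  proof (rule exists_nonsingular_evaluation[where g = "\<lambda>i s. c s (x i)"])
    fix i and v :: "nat \<Rightarrow> real"
    assume v: "\<forall>s\<in>UNIV. (\<Sum>i<k. v i * c s (x i)) = 0" and i: "i < k"
    have zero: "(\<Sum>i<k. v i * \<psi> (x i) (y j)) = 0" if "j < k" for j
      using taylor_functions_linear_combination[of U V \<psi> p c k x "y j" v] c x y[OF that] v
      by (simp add: homogeneous_part_def[abs_def] sums_iff)
    show "v i = 0"
      by (rule det_nonzero_imp_left_kernel_trivial[OF det _ i, where v = v]) (simp add: zero)
  qed
  then obtain s where det': "Determinant.det (Matrix.mat k k (\<lambda>(i, j). c (s j) (x i))) \<noteq> 0"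
    by blast
  \<comment> \<open>A repeated multi-index would give two equal columns.\<close>
  have inj: "inj_on s {..<k}"
  proof (rule inj_onI, rule ccontr)
    fix j j' assume *: "j \<in> {..<k}" "j' \<in> {..<k}" "s j = s j'" "j \<noteq> j'"
    have "Determinant.det (Matrix.mat k k (\<lambda>(i, j). c (s j) (x i))) = 0"
      by (rule det_identical_columns[of _ k j j']) (use * in \<open>auto intro!: eq_vecI\<close>)
    thus False using det' by blast
  qed
  have "locally_lin_indep (s ` {..<k}) c U"
    unfolding locally_lin_indep_def
  proof (intro allI impI iffI)
    fix W \<alpha> assume W: "open W \<and> W \<noteq> {} \<and> W \<subseteq> U"
      and ae: "AE x in lebesgue. x \<in> W \<longrightarrow> (\<Sum>t\<in>s ` {..<k}. \<alpha> t * c t x) = 0"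
    let ?f = "\<lambda>x. \<Sum>t\<in>s ` {..<k}. \<alpha> t * c t x"
    \<comment> \<open>The points \<open>x i\<close> need not lie in \<open>W\<close>: the relation
      is carried from almost all of \<open>W\<close> to all of it by continuity, and on to
      \<open>U\<close> by the identity theorem.\<close>
    have f: "real_analytic_on ?f U"
      using assms(1) analytic by (intro real_analytic_on_linear_combination) auto
    have "continuous_on W ?f"
      using real_analytic_on_imp_continuous_on[OF f] W continuous_on_subset by blast
    hence "?f x = 0" if "x \<in> W" for x
      using AE_zero_imp_zero_on_open[of W ?f x] W ae that by blast
    hence zero: "?f x = 0" if "x \<in> U" for x
      using real_analytic_on_identity[OF f \<open>connected U\<close>, of W x] W that by blast
    have "\<alpha> (s j) = 0" if "j < k" for j
    proof (rule det_nonzero_imp_right_kernel_trivial[OF det' _ that, where v = "\<lambda>j. \<alpha> (s j)"])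
      fix i assume "i < k"
      from zero[OF x[OF this]] show "(\<Sum>j<k. (case (i, j) of (i, j) \<Rightarrow> c (s j) (x i)) * \<alpha> (s j)) = 0"
        by (simp add: sum.reindex[OF inj] mult.commute)
    qed
    thus "\<forall>t\<in>s ` {..<k}. \<alpha> t = 0" by blast
  next
    fix W \<alpha> assume "\<forall>t\<in>s ` {..<k}. \<alpha> t = (0 :: real)"
    thus "AE x in lebesgue. x \<in> W \<longrightarrow> (\<Sum>t\<in>s ` {..<k}. \<alpha> t * c t x) = 0"
      by (intro AE_I2 impI sum.neutral) auto
  qed
  moreover have "card (s ` {..<k}) = k" using card_image[OF inj] by simp
  ultimately show ?thesis by blast
qed

theorem corollary1:
  fixes U V :: "(real ^ 'n::finite) set"
    and \<psi> :: "real ^ 'n \<Rightarrow> real ^ 'n \<Rightarrow> real"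
  assumes "open U" "connected U" "open V" "connected V"
    and "analytic_in_both U V \<psi>"
  shows "full_rank_ae U V \<psi> \<longleftrightarrow>
    (\<forall>p\<in>V. \<forall>c. taylor_functions U V \<psi> p c \<longrightarrow>
      (\<forall>k. \<exists>S. finite S \<and> card S = k \<and> locally_lin_indep S c U))"
proof
  assume rank: "full_rank_ae U V \<psi>"
  show "\<forall>p\<in>V. \<forall>c. taylor_functions U V \<psi> p c \<longrightarrow>
      (\<forall>k. \<exists>S. finite S \<and> card S = k \<and> locally_lin_indep S c U)"
  proof (intro ballI allI impI)
    fix p c and k :: nat assume p: "p \<in> V" and c: "taylor_functions U V \<psi> p c"
    have "real_analytic_on (c s) U" for s
      using assms(5) p c unfolding analytic_in_both_def by blast
    thus "\<exists>S. finite S \<and> card S = k \<and> locally_lin_indep S c U"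
      using assms(1-3) p rank c by (intro full_rank_ae_imp_locally_lin_indep) auto
  qed
next
  assume indep: "\<forall>p\<in>V. \<forall>c. taylor_functions U V \<psi> p c \<longrightarrow>
      (\<forall>k. \<exists>S. finite S \<and> card S = k \<and> locally_lin_indep S c U)"
  show "full_rank_ae U V \<psi>"
  proof (cases "V = {}")
    case True
    show ?thesis
      unfolding full_rank_ae_iff_det
    proof (intro allI impI)
      fix k :: nat and A B :: "nat \<Rightarrow> (real ^ 'n) set"
      assume "\<forall>j<k. open (B j) \<and> B j \<noteq> {} \<and> B j \<subseteq> V"
      \<comment> \<open>Without nonempty subsets of \<open>V\<close> only \<open>k = 0\<close>
        remains, and the empty determinant is 1.\<close>
      hence "k = 0" using True by (metis gr0I subset_empty)
      thus "\<exists>x y. (\<forall>i<k. x i \<in> A i) \<and> (\<forall>j<k. y j \<in> B j) \<and>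
          Determinant.det (Matrix.mat k k (\<lambda>(i, j). \<psi> (x i) (y j))) \<noteq> 0" by simp
    qed
  next
    case False
    then obtain p where p: "p \<in> V" by blast
    then obtain c where c: "taylor_functions U V \<psi> p c"
      using assms(5) unfolding analytic_in_both_def analytic_in_second_def by blast
    \<comment> \<open>One centre and one expansion serve for all \<open>k\<close>.\<close>
    show ?thesis using indep p c by (intro locally_lin_indep_imp_full_rank_ae) blast
  qed
qed

end
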